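(* Let $p\ge\sqrt3$, and let $u:\mathbf{R}\times\mathbf{R}\to\mathbf{R}$ be a global Schwartz solution, not identically zero, of the defocusing generalised Korteweg-de Vries equation $$\partial_tu+\partial_{xxx}u=\partial_x(|u|^{p-1}u).$$ Then, for every time $t$, $$\partial_t\langle x\rangle_M-\partial_t\langle x\rangle_E>0.$$ In particular, the quantity $\langle x\rangle_E-\langle x\rangle_M$ is strictly monotone decreasing in time. Moreover, for every function $x:\mathbf{R}\to\mathbf{R}$, $t\mapsto x(t)$, $$\sup_{t\in\mathbf{R}}\int_{\mathbf{R}}|x-x(t)|\,[\rho(t,x)+e(t,x)]\,dx=+\infty.$$
   Context: A Schwartz solution is a smooth solution $u$ such that all spacetime derivatives of $u$ are, at each time $t$, Schwartz functions of $x$, locally uniformly in $t$. The mass density and energy density are $$\rho(t,x):=u(t,x)^2,\qquad e(t,x):=\tfrac12u_x(t,x)^2+\tfrac1{p+1}|u(t,x)|^{p+1}.$$ The mass and energy are $M(u):=\int_{\mathbf{R}}\rho(t,x)\,dx$ and $E(u):=\int_{\mathbf{R}}e(t,x)\,dx$; both are independent of $t$. The centre-of-mass and centre-of-energy are the functions of $t$ given by $$\langle x\rangle_M:=\frac1{M(u)}\int_{\mathbf{R}}x\,\rho(t,x)\,dx,\qquad \langle x\rangle_E:=\frac1{E(u)}\int_{\mathbf{R}}x\,e(t,x)\,dx.$$ *)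

theory Defs
  imports "HOL-Analysis.Analysis"
begin

text \<open>A function of time and space is a curried \<open>u :: real \<Rightarrow> real \<Rightarrow> real\<close>, read as \<open>u t x\<close>.\<close>

definition D_t :: "(real \<Rightarrow> real \<Rightarrow> real) \<Rightarrow> real \<Rightarrow> real \<Rightarrow> real" where
  "D_t u = (\<lambda>t x. deriv (\<lambda>s. u s x) t)"

definition D_x :: "(real \<Rightarrow> real \<Rightarrow> real) \<Rightarrow> real \<Rightarrow> real \<Rightarrow> real" where
  "D_x u = (\<lambda>t x. deriv (\<lambda>y. u t y) x)"

inductive_set spacetime_derivatives :: "(real \<Rightarrow> real \<Rightarrow> real) \<Rightarrow> (real \<Rightarrow> real \<Rightarrow> real) set"
  for u where
  base: "u \<in> spacetime_derivatives u"
| time: "v \<in> spacetime_derivatives u \<Longrightarrow> D_t v \<in> spacetime_derivatives u"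
| space: "v \<in> spacetime_derivatives u \<Longrightarrow> D_x v \<in> spacetime_derivatives u"

text \<open>
  Joint (Frechet) differentiability of every iterated partial derivative on the plane is the same
  as being \<open>C\<^sup>\<infinity>\<close>. It also ensures that \<^const>\<open>deriv\<close>, a total function, is applied
  only to differentiable functions in \<open>spacetime_derivatives u\<close>.
\<close>

definition smooth :: "(real \<Rightarrow> real \<Rightarrow> real) \<Rightarrow> bool" where
  "smooth u \<longleftrightarrow> (\<forall>v\<in>spacetime_derivatives u. (\<lambda>(t, x). v t x) differentiable_on UNIV)"

text \<open>The Schwartz seminorms of \<open>v t\<close> are bounded, uniformly for \<open>t\<close> in any compact set.\<close>

definition schwartz_locally_uniformly :: "(real \<Rightarrow> real \<Rightarrow> real) \<Rightarrow> bool" where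
  "schwartz_locally_uniformly v \<longleftrightarrow>
     (\<forall>K. compact K \<longrightarrow>
       (\<forall>j k. \<exists>C. \<forall>t\<in>K. \<forall>x. \<bar>x\<bar> ^ j * \<bar>(D_x ^^ k) v t x\<bar> \<le> C))"

definition gKdV_equation :: "real \<Rightarrow> (real \<Rightarrow> real \<Rightarrow> real) \<Rightarrow> bool" where
  "gKdV_equation p u \<longleftrightarrow>
     (\<forall>t x. D_t u t x + D_x (D_x (D_x u)) t x
          = D_x (\<lambda>t x. \<bar>u t x\<bar> powr (p - 1) * u t x) t x)"

definition global_schwartz_solution :: "real \<Rightarrow> (real \<Rightarrow> real \<Rightarrow> real) \<Rightarrow> bool" where
  "global_schwartz_solution p u \<longleftrightarrow>
     smooth u \<and> gKdV_equation p u \<and> (\<forall>v\<in>spacetime_derivatives u. schwartz_locally_uniformly v)"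

definition mass_density :: "(real \<Rightarrow> real \<Rightarrow> real) \<Rightarrow> real \<Rightarrow> real \<Rightarrow> real" where
  "mass_density u t x = (u t x)\<^sup>2"

definition energy_density :: "real \<Rightarrow> (real \<Rightarrow> real \<Rightarrow> real) \<Rightarrow> real \<Rightarrow> real \<Rightarrow> real" where
  "energy_density p u t x = 1/2 * (D_x u t x)\<^sup>2 + 1/(p + 1) * \<bar>u t x\<bar> powr (p + 1)"

text \<open>
  Mass and energy carry the time argument; that they do not depend on it for solutions is a
  consequence of the equation and is not built into the definitions.
\<close>

definition mass :: "(real \<Rightarrow> real \<Rightarrow> real) \<Rightarrow> real \<Rightarrow> real" where
  "mass u t = (\<integral>x. mass_density u t x \<partial>lborel)"

definition energy :: "real \<Rightarrow> (real \<Rightarrow> real \<Rightarrow> real) \<Rightarrow> real \<Rightarrow> real" where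
  "energy p u t = (\<integral>x. energy_density p u t x \<partial>lborel)"

definition centre_of_mass :: "(real \<Rightarrow> real \<Rightarrow> real) \<Rightarrow> real \<Rightarrow> real" where
  "centre_of_mass u t = 1 / mass u t * (\<integral>x. x * mass_density u t x \<partial>lborel)"

definition centre_of_energy :: "real \<Rightarrow> (real \<Rightarrow> real \<Rightarrow> real) \<Rightarrow> real \<Rightarrow> real" where
  "centre_of_energy p u t = 1 / energy p u t * (\<integral>x. x * energy_density p u t x \<partial>lborel)"

end

theory Submission
  imports Defs "HOL-Probability.Sinc_Integral" "HOL-Real_Asymp.Real_Asymp"
begin

text \<open>
  Write \<open>f = |u|\<^sup>p\<^sup>-\<^sup>1 u\<close> and \<open>w = u\<^sub>x\<^sub>x - f\<close>, so that the equation is \<open>u\<^sub>t = - w\<^sub>x\<close>. Both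
  densities obey a conservation law:
  \<open>\<rho>\<^sub>t = (u\<^sub>x\<^sup>2 - 2 u u\<^sub>x\<^sub>x + 2p/(p+1) u f)\<^sub>x\<close> and \<open>e\<^sub>t = (u\<^sub>x u\<^sub>t + w\<^sup>2/2)\<^sub>x\<close>.
  Integrating these against \<open>1\<close> and \<open>x\<close> and then by parts shows that \<open>M\<close> and \<open>E\<close> are constant and that
  \<open>M \<partial>\<^sub>t\<langle>x\<rangle>\<^sub>M = - (3 \<integral>u\<^sub>x\<^sup>2 + 2p/(p+1) \<integral>u f)\<close>,
  \<open>E \<partial>\<^sub>t\<langle>x\<rangle>\<^sub>E = - (3/2 \<integral>u\<^sub>x\<^sub>x\<^sup>2 - 2 \<integral>u\<^sub>x\<^sub>x f + 1/2 \<integral>f\<^sup>2)\<close>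
  (\<open>mass_conservation\<close>, \<open>energy_conservation\<close>). The two brackets are the total mass flux and the
  total energy flux.

  To compare the two speeds, apply Cauchy-Schwarz to \<open>u\<close> and \<open>\<surd>3 u\<^sub>x\<^sub>x - f\<close>. Since
  \<open>\<integral>u u\<^sub>x\<^sub>x = - \<integral>u\<^sub>x\<^sup>2\<close>, this reads
  \<open>(\<surd>3 \<integral>u\<^sub>x\<^sup>2 + \<integral>u f)\<^sup>2 \<le> M (3 \<integral>u\<^sub>x\<^sub>x\<^sup>2 - 2\<surd>3 \<integral>u\<^sub>x\<^sub>x f + \<integral>f\<^sup>2)\<close>.
  The right-hand side is at most twice \<open>M\<close> times the energy flux, because
  \<open>\<integral>u\<^sub>x\<^sub>x f = - p \<integral>|u|\<^sup>p\<^sup>-\<^sup>1 u\<^sub>x\<^sup>2 \<le> 0\<close> and \<open>\<surd>3 \<le> 2\<close>. On the left, half of the square exceeds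
  \<open>E\<close> times the mass flux as soon as the cross term is large enough, i.e. \<open>(p+3)/(p+1) \<le> \<surd>3\<close>, which
  is precisely \<open>p \<ge> \<surd>3\<close>; the coefficients of \<open>(\<integral>u f)\<^sup>2\<close> even leave the surplus
  \<open>\<kappa> (\<integral>u f)\<^sup>2\<close> with \<open>\<kappa> = (p-1)\<^sup>2 / (2 (p+1)\<^sup>2) > 0\<close>. Hence (\<open>separation_speed\<close>)
  \<open>\<partial>\<^sub>t\<langle>x\<rangle>\<^sub>M - \<partial>\<^sub>t\<langle>x\<rangle>\<^sub>E \<ge> \<kappa> (\<integral>u f)\<^sup>2 / (M E) > 0\<close>.

  For the last claim, suppose that the first absolute moments about \<open>x(t)\<close> stay bounded. Then both
  centres stay within a bounded distance of \<open>x(t)\<close>, hence of each other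
  (\<open>centres_close_if_confined\<close>). On the other hand, half of the mass then lies in an interval of fixed
  length about \<open>x(t)\<close>, which bounds \<open>\<integral>u f = \<integral>|u|\<^sup>p\<^sup>+\<^sup>1\<close> from below uniformly in time
  (\<open>int_u_f_lower_bound_if_confined\<close>), so the centres separate at a speed bounded away from zero.
  These two conclusions contradict each other.
\<close>

section \<open>Rapidly decreasing functions\<close>

text \<open>
  The derivatives of \<open>u\<close>, the densities and the fluxes have this property. Continuity in \<open>x\<close> is
  included so that membership alone yields measurability, integrability and the fundamental theorem
  of calculus on the line.
\<close>

definition rapidly_decreasing :: "(real \<Rightarrow> real \<Rightarrow> real) \<Rightarrow> bool" where
  "rapidly_decreasing g \<longleftrightarrow>
     (\<forall>t. continuous_on UNIV (g t)) \<and>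
     (\<forall>a b j. \<exists>C. \<forall>t\<in>{a..b}. \<forall>x. \<bar>x\<bar> ^ j * \<bar>g t x\<bar> \<le> C)"

text \<open>
  Multipliers that preserve rapid decrease: constants, and the power \<open>|u|\<^sup>p\<^sup>-\<^sup>1\<close>, which only ever
  occurs together with a rapidly decreasing factor.
\<close>

definition slab_bounded :: "(real \<Rightarrow> real \<Rightarrow> real) \<Rightarrow> bool" where
  "slab_bounded g \<longleftrightarrow>
     (\<forall>t. continuous_on UNIV (g t)) \<and> (\<forall>a b. \<exists>C. \<forall>t\<in>{a..b}. \<forall>x. \<bar>g t x\<bar> \<le> C)"

lemma rapidly_decreasing_continuous: "rapidly_decreasing g \<Longrightarrow> continuous_on UNIV (g t)"
  by (simp add: rapidly_decreasing_def)

lemma rapidly_decreasing_bound: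
  assumes "rapidly_decreasing g"
  obtains C where "\<And>t x. t \<in> {a..b} \<Longrightarrow> \<bar>x\<bar> ^ j * \<bar>g t x\<bar> \<le> C"
  using assms unfolding rapidly_decreasing_def by meson

lemma slab_bounded_bound:
  assumes "slab_bounded g"
  obtains C where "\<And>t x. t \<in> {a..b} \<Longrightarrow> \<bar>g t x\<bar> \<le> C"
  using assms unfolding slab_bounded_def by meson

lemma rapidly_decreasing_imp_slab_bounded:
  assumes "rapidly_decreasing g" shows "slab_bounded g"
  unfolding slab_bounded_def
proof (intro conjI allI)
  show "continuous_on UNIV (g t)" for t
    using assms by (rule rapidly_decreasing_continuous)
  fix a b
  obtain C where "\<And>t x. t \<in> {a..b} \<Longrightarrow> \<bar>x\<bar> ^ 0 * \<bar>g t x\<bar> \<le> C"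
    using rapidly_decreasing_bound[OF assms] by metis
  then have "\<bar>g t x\<bar> \<le> C" if "t \<in> {a..b}" for t x using that by simp
  then show "\<exists>C. \<forall>t\<in>{a..b}. \<forall>x. \<bar>g t x\<bar> \<le> C" by blast
qed

lemma rapidly_decreasing_mult_bounded:
  assumes h: "slab_bounded h" and g: "rapidly_decreasing g"
  shows "rapidly_decreasing (\<lambda>t x. h t x * g t x)"
  unfolding rapidly_decreasing_def
proof (intro conjI allI)
  show "continuous_on UNIV (\<lambda>x. h t x * g t x)" for t
    using h g by (intro continuous_on_mult) (auto simp: slab_bounded_def rapidly_decreasing_def)
  fix a b j
  obtain B where B: "\<And>t x. t \<in> {a..b} \<Longrightarrow> \<bar>h t x\<bar> \<le> B"
    using slab_bounded_bound[OF h] by metis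
  obtain C where C: "\<And>t x. t \<in> {a..b} \<Longrightarrow> \<bar>x\<bar> ^ j * \<bar>g t x\<bar> \<le> C"
    using rapidly_decreasing_bound[OF g] by metis
  have "\<bar>x\<bar> ^ j * \<bar>h t x * g t x\<bar> \<le> B * C" if "t \<in> {a..b}" for t x
  proof -
    have "\<bar>h t x\<bar> * (\<bar>x\<bar> ^ j * \<bar>g t x\<bar>) \<le> B * C"
      using B[OF that, of x] C[OF that, of x] by (intro mult_mono) auto
    then show ?thesis by (simp add: abs_mult mult_ac)
  qed
  then show "\<exists>C. \<forall>t\<in>{a..b}. \<forall>x. \<bar>x\<bar> ^ j * \<bar>h t x * g t x\<bar> \<le> C" by blast
qed

lemma rapidly_decreasing_mult:
  "rapidly_decreasing f \<Longrightarrow> rapidly_decreasing g \<Longrightarrow> rapidly_decreasing (\<lambda>t x. f t x * g t x)"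
  by (intro rapidly_decreasing_mult_bounded rapidly_decreasing_imp_slab_bounded)

lemma rapidly_decreasing_cmult:
  "rapidly_decreasing g \<Longrightarrow> rapidly_decreasing (\<lambda>t x. c * g t x)"
  by (rule rapidly_decreasing_mult_bounded) (auto simp: slab_bounded_def)

lemma rapidly_decreasing_add:
  assumes f: "rapidly_decreasing f" and g: "rapidly_decreasing g"
  shows "rapidly_decreasing (\<lambda>t x. f t x + g t x)"
  unfolding rapidly_decreasing_def
proof (intro conjI allI)
  show "continuous_on UNIV (\<lambda>x. f t x + g t x)" for t
    using f g by (intro continuous_on_add) (auto simp: rapidly_decreasing_def)
  fix a b j
  obtain B where B: "\<And>t x. t \<in> {a..b} \<Longrightarrow> \<bar>x\<bar> ^ j * \<bar>f t x\<bar> \<le> B"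
    using rapidly_decreasing_bound[OF f] by metis
  obtain C where C: "\<And>t x. t \<in> {a..b} \<Longrightarrow> \<bar>x\<bar> ^ j * \<bar>g t x\<bar> \<le> C"
    using rapidly_decreasing_bound[OF g] by metis
  have "\<bar>x\<bar> ^ j * \<bar>f t x + g t x\<bar> \<le> B + C" if "t \<in> {a..b}" for t x
  proof -
    have "\<bar>x\<bar> ^ j * \<bar>f t x + g t x\<bar> \<le> \<bar>x\<bar> ^ j * (\<bar>f t x\<bar> + \<bar>g t x\<bar>)"
      by (intro mult_left_mono) auto
    also have "\<dots> \<le> B + C"
      using B[OF that, of x] C[OF that, of x] by (simp add: distrib_left)
    finally show ?thesis .
  qed
  then show "\<exists>C. \<forall>t\<in>{a..b}. \<forall>x. \<bar>x\<bar> ^ j * \<bar>f t x + g t x\<bar> \<le> C" by blast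
qed

lemma rapidly_decreasing_diff:
  "rapidly_decreasing f \<Longrightarrow> rapidly_decreasing g \<Longrightarrow> rapidly_decreasing (\<lambda>t x. f t x - g t x)"
  using rapidly_decreasing_add[OF _ rapidly_decreasing_cmult[of g "-1"], of f] by simp

lemma rapidly_decreasing_mult_x:
  assumes g: "rapidly_decreasing g"
  shows "rapidly_decreasing (\<lambda>t x. x * g t x)"
  unfolding rapidly_decreasing_def
proof (intro conjI allI)
  show "continuous_on UNIV (\<lambda>x. x * g t x)" for t
    using g by (intro continuous_intros) (auto simp: rapidly_decreasing_def)
  fix a b j
  obtain C where "\<And>t x. t \<in> {a..b} \<Longrightarrow> \<bar>x\<bar> ^ Suc j * \<bar>g t x\<bar> \<le> C"
    using rapidly_decreasing_bound[OF g] by metis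
  then have "\<bar>x\<bar> ^ j * \<bar>x * g t x\<bar> \<le> C" if "t \<in> {a..b}" for t x
    using that by (simp add: abs_mult mult_ac)
  then show "\<exists>C. \<forall>t\<in>{a..b}. \<forall>x. \<bar>x\<bar> ^ j * \<bar>x * g t x\<bar> \<le> C" by blast
qed

lemma rapidly_decreasing_power2:
  "rapidly_decreasing g \<Longrightarrow> rapidly_decreasing (\<lambda>t x. (g t x)\<^sup>2)"
  using rapidly_decreasing_mult[of g g] by (simp add: power2_eq_square)

lemmas rapidly_decreasing_intros =
  rapidly_decreasing_mult rapidly_decreasing_cmult rapidly_decreasing_add rapidly_decreasing_diff
  rapidly_decreasing_mult_x rapidly_decreasing_power2

text \<open>
  An integrable majorant, uniform over a time interval: the exponents \<open>0\<close> and \<open>2\<close> suffice.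
\<close>

lemma rapidly_decreasing_quadratic_bound:
  assumes g: "rapidly_decreasing g"
  obtains C where "\<And>t x. t \<in> {a..b} \<Longrightarrow> \<bar>g t x\<bar> \<le> C * inverse (1 + x\<^sup>2)"
proof -
  obtain B where B: "\<And>t x. t \<in> {a..b} \<Longrightarrow> \<bar>x\<bar> ^ 0 * \<bar>g t x\<bar> \<le> B"
    using rapidly_decreasing_bound[OF g] by metis
  obtain C where C: "\<And>t x. t \<in> {a..b} \<Longrightarrow> \<bar>x\<bar> ^ 2 * \<bar>g t x\<bar> \<le> C"
    using rapidly_decreasing_bound[OF g] by metis
  have "\<bar>g t x\<bar> \<le> (B + C) * inverse (1 + x\<^sup>2)" if "t \<in> {a..b}" for t x
  proof -
    have "(1 + x\<^sup>2) * \<bar>g t x\<bar> \<le> B + C"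
      using B[OF that, of x] C[OF that, of x] by (simp add: algebra_simps)
    moreover have "0 < 1 + x\<^sup>2" by (rule add_pos_nonneg) auto
    ultimately show ?thesis by (simp add: field_simps)
  qed
  then show thesis by (rule that)
qed

lemma integrable_cauchy_density: "integrable lborel (\<lambda>x::real. C * inverse (1 + x\<^sup>2))"
  using integrable_inverse_1_plus_square by (simp add: set_integrable_def)

lemma rapidly_decreasing_measurable:
  "rapidly_decreasing g \<Longrightarrow> g t \<in> borel_measurable borel"
  by (rule borel_measurable_continuous_onI) (rule rapidly_decreasing_continuous)

lemma rapidly_decreasing_integrable:
  assumes g: "rapidly_decreasing g"
  shows "integrable lborel (g t)"
proof -
  obtain C where C: "\<And>s x. s \<in> {t..t} \<Longrightarrow> \<bar>g s x\<bar> \<le> C * inverse (1 + x\<^sup>2)"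
    using rapidly_decreasing_quadratic_bound[OF g] by metis
  show ?thesis
  proof (rule Bochner_Integration.integrable_bound[OF integrable_cauchy_density[of C]])
    show "g t \<in> borel_measurable lborel"
      using rapidly_decreasing_measurable[OF g] by simp
    have "norm (g t x) \<le> norm (C * inverse (1 + x\<^sup>2))" for x
      using order_trans[OF C[of t x] abs_ge_self] by simp
    then show "AE x in lborel. norm (g t x) \<le> norm (C * inverse (1 + x\<^sup>2))" by simp
  qed
qed

lemma rapidly_decreasing_tendsto:
  assumes g: "rapidly_decreasing g"
  shows "(g t \<longlongrightarrow> 0) at_top" and "(g t \<longlongrightarrow> 0) at_bot"
proof -
  obtain C where C: "\<And>s x. s \<in> {t..t} \<Longrightarrow> \<bar>g s x\<bar> \<le> C * inverse (1 + x\<^sup>2)"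
    using rapidly_decreasing_quadratic_bound[OF g] by metis
  have b: "norm (g t x) \<le> C * inverse (1 + x\<^sup>2)" for x using C[of t x] by simp
  have "((\<lambda>x. C * inverse (1 + x\<^sup>2)) \<longlongrightarrow> 0) at_top" by real_asymp
  then show "(g t \<longlongrightarrow> 0) at_top"
    by (rule Lim_null_comparison[rotated]) (intro always_eventually allI b)
  have "((\<lambda>x. C * inverse (1 + x\<^sup>2)) \<longlongrightarrow> 0) at_bot" by real_asymp
  then show "(g t \<longlongrightarrow> 0) at_bot"
    by (rule Lim_null_comparison[rotated]) (intro always_eventually allI b)
qed

section \<open>Integrals of densities over the line\<close>

lemma integral_of_derivative_zero:
  assumes F: "rapidly_decreasing F" and F': "rapidly_decreasing F'"
    and deriv: "\<And>x. (F t has_real_derivative F' t x) (at x)"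
  shows "(\<integral>x. F' t x \<partial>lborel) = 0"
proof -
  have "(LBINT x=-\<infinity>..\<infinity>. F' t x) = 0 - 0"
  proof (rule interval_integral_FTC_integrable)
    show "(F t has_vector_derivative F' t x) (at x)" for x
      using deriv by (simp add: has_real_derivative_iff_has_vector_derivative)
    show "isCont (F' t) x" for x
      using rapidly_decreasing_continuous[OF F'] by (simp add: continuous_on_eq_continuous_at)
    show "set_integrable lborel (einterval (-\<infinity>) \<infinity>) (F' t)"
      using rapidly_decreasing_integrable[OF F'] by (simp add: set_integrable_def)
  qed (use rapidly_decreasing_tendsto[OF F] in \<open>simp_all add: ereal_tendsto_simps\<close>)
  then show ?thesis
    by (simp add: interval_lebesgue_integral_def set_lebesgue_integral_def)
qed

lemma integral_x_derivative:
  assumes F: "rapidly_decreasing F" and F': "rapidly_decreasing F'"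
    and deriv: "\<And>x. (F t has_real_derivative F' t x) (at x)"
  shows "(\<integral>x. x * F' t x \<partial>lborel) = - (\<integral>x. F t x \<partial>lborel)"
proof -
  have "(\<integral>x. F t x + x * F' t x \<partial>lborel) = 0"
    by (rule integral_of_derivative_zero[of "\<lambda>t x. x * F t x" "\<lambda>t x. F t x + x * F' t x"])
       (auto intro!: rapidly_decreasing_intros F F' derivative_eq_intros deriv)
  then show ?thesis
    using rapidly_decreasing_integrable[OF F, of t]
      rapidly_decreasing_integrable[OF rapidly_decreasing_mult_x[OF F'], of t]
    by simp
qed

lemma integral_by_parts:
  assumes FG: "rapidly_decreasing (\<lambda>t x. F t x * G t x)"
    and F'G: "rapidly_decreasing (\<lambda>t x. F' t x * G t x)"
    and FG': "rapidly_decreasing (\<lambda>t x. F t x * G' t x)"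
    and F: "\<And>x. (F t has_real_derivative F' t x) (at x)"
    and G: "\<And>x. (G t has_real_derivative G' t x) (at x)"
  shows "(\<integral>x. F t x * G' t x \<partial>lborel) = - (\<integral>x. F' t x * G t x \<partial>lborel)"
proof -
  have "(\<integral>x. F' t x * G t x + F t x * G' t x \<partial>lborel) = 0"
    by (rule integral_of_derivative_zero[of "\<lambda>t x. F t x * G t x"
          "\<lambda>t x. F' t x * G t x + F t x * G' t x"])
       (auto intro!: rapidly_decreasing_add FG F'G FG' derivative_eq_intros F G)
  then show ?thesis
    using rapidly_decreasing_integrable[OF F'G, of t] rapidly_decreasing_integrable[OF FG', of t]
    by simp
qed

text \<open>
  By the mean value theorem, the difference quotients of \<open>g\<close> on \<open>[t-1, t+1]\<close> inherit the
  integrable majorant of \<open>h\<close>, so dominated convergence applies along every sequence tending to \<open>0\<close>.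
\<close>

lemma has_derivative_under_integral:
  assumes g: "rapidly_decreasing g" and h: "rapidly_decreasing h"
    and deriv: "\<And>t x. ((\<lambda>t. g t x) has_real_derivative h t x) (at t)"
  shows "((\<lambda>t. \<integral>x. g t x \<partial>lborel) has_real_derivative (\<integral>x. h t x \<partial>lborel)) (at t)"
  unfolding DERIV_def
proof (rule tendsto_at_iff_sequentially[THEN iffD2], intro allI impI)
  fix X :: "nat \<Rightarrow> real"
  assume X: "\<forall>i. X i \<in> UNIV - {0}" "X \<longlonglongrightarrow> 0"
  obtain C where C: "\<And>s x. s \<in> {t-1..t+1} \<Longrightarrow> \<bar>h s x\<bar> \<le> C * inverse (1 + x\<^sup>2)"
    using rapidly_decreasing_quadratic_bound[OF h] by metis
  obtain N where N: "\<And>n. n \<ge> N \<Longrightarrow> \<bar>X n\<bar> < 1"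
    using X(2) LIMSEQ_D[of X 0 1] by auto
  define Y where step_def: "Y n = X (n + N)" for n
  have Y: "Y n \<noteq> 0" "\<bar>Y n\<bar> < 1" for n
    using X(1) N by (auto simp: step_def)
  have "Y \<longlonglongrightarrow> 0" unfolding step_def using X(2) by (rule LIMSEQ_ignore_initial_segment)
  have "(\<lambda>n. \<integral>x. (g (t + Y n) x - g t x) / Y n \<partial>lborel) \<longlonglongrightarrow> (\<integral>x. h t x \<partial>lborel)"
  proof (rule integral_dominated_convergence)
    show "integrable lborel (\<lambda>x. C * inverse (1 + x\<^sup>2))" by (rule integrable_cauchy_density)
    show "h t \<in> borel_measurable lborel"
      using rapidly_decreasing_measurable[OF h] by simp
    show "(\<lambda>x. (g (t + Y n) x - g t x) / Y n) \<in> borel_measurable lborel" for n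
      using rapidly_decreasing_measurable[OF g] by simp
    have "(\<lambda>n. (g (t + Y n) x - g t x) / Y n) \<longlonglongrightarrow> h t x" for x
    proof -
      have "((\<lambda>k. (g (t + k) x - g t x) / k) \<longlongrightarrow> h t x) (at 0)"
        using deriv[of x t] by (simp add: DERIV_def)
      moreover have "filterlim Y (at 0) sequentially"
        using \<open>Y \<longlonglongrightarrow> 0\<close> Y(1) by (simp add: filterlim_at)
      ultimately show ?thesis by (rule filterlim_compose)
    qed
    then show "AE x in lborel. (\<lambda>n. (g (t + Y n) x - g t x) / Y n) \<longlonglongrightarrow> h t x" by simp
    have "\<bar>g (t + Y n) x - g t x\<bar> \<le> \<bar>Y n\<bar> * (C * inverse (1 + x\<^sup>2))" for n x
    proof -
      have "norm (g (t + Y n) x - g t x) \<le> (C * inverse (1 + x\<^sup>2)) * norm (t + Y n - t)"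
      proof (rule field_differentiable_bound[of "{t-1..t+1}" "\<lambda>s. g s x" "\<lambda>s. h s x"])
        show "((\<lambda>s. g s x) has_field_derivative h s x) (at s within {t-1..t+1})" for s
          using deriv by (rule has_field_derivative_at_within)
        show "norm (h s x) \<le> C * inverse (1 + x\<^sup>2)" if "s \<in> {t-1..t+1}" for s
          using C[OF that] by simp
      qed (use Y(2)[of n] in auto)
      then show ?thesis by (simp add: mult.commute)
    qed
    then show "AE x in lborel. norm ((g (t + Y n) x - g t x) / Y n) \<le> C * inverse (1 + x\<^sup>2)" for n
      using Y(1)[of n] by (simp add: field_simps)
  qed
  moreover have "(\<integral>x. (g (t + k) x - g t x) / k \<partial>lborel)
      = ((\<integral>x. g (t + k) x \<partial>lborel) - (\<integral>x. g t x \<partial>lborel)) / k" for k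
    using rapidly_decreasing_integrable[OF g] by simp
  ultimately have "(\<lambda>n. ((\<integral>x. g (t + Y n) x \<partial>lborel) - (\<integral>x. g t x \<partial>lborel)) / Y n)
      \<longlonglongrightarrow> (\<integral>x. h t x \<partial>lborel)"
    by (simp only:)
  then have "(\<lambda>n. ((\<integral>x. g (t + X (n + N)) x \<partial>lborel) - (\<integral>x. g t x \<partial>lborel)) / X (n + N))
      \<longlonglongrightarrow> (\<integral>x. h t x \<partial>lborel)"
    unfolding step_def .
  then have "(\<lambda>n. ((\<integral>x. g (t + X n) x \<partial>lborel) - (\<integral>x. g t x \<partial>lborel)) / X n)
      \<longlonglongrightarrow> (\<integral>x. h t x \<partial>lborel)"
    by (rule LIMSEQ_offset)
  then show "((\<lambda>k. ((\<integral>x. g (t + k) x \<partial>lborel) - (\<integral>x. g t x \<partial>lborel)) / k) \<circ> X)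
      \<longlonglongrightarrow> (\<integral>x. h t x \<partial>lborel)"
    by (simp add: o_def)
qed

text \<open>
  The integrated form of \<open>g\<^sub>t = F\<^sub>x\<close>: the total of \<open>g\<close> is constant, and its first moment moves
  with minus the total flux, by one integration by parts.
\<close>

lemma conservation_law:
  assumes g: "rapidly_decreasing g" and F: "rapidly_decreasing F" and h: "rapidly_decreasing h"
    and time: "\<And>t x. ((\<lambda>t. g t x) has_real_derivative h t x) (at t)"
    and space: "\<And>t x. (F t has_real_derivative h t x) (at x)"
  shows "((\<lambda>t. \<integral>x. g t x \<partial>lborel) has_real_derivative 0) (at t)"
    and "((\<lambda>t. \<integral>x. x * g t x \<partial>lborel) has_real_derivative - (\<integral>x. F t x \<partial>lborel)) (at t)"
proof -
  show "((\<lambda>t. \<integral>x. g t x \<partial>lborel) has_real_derivative 0) (at t)"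
    using has_derivative_under_integral[OF g h time, of t]
      integral_of_derivative_zero[OF F h space, of t] by simp
  have "((\<lambda>t. \<integral>x. x * g t x \<partial>lborel) has_real_derivative (\<integral>x. x * h t x \<partial>lborel)) (at t)"
    by (rule has_derivative_under_integral)
       (auto intro!: rapidly_decreasing_intros g h derivative_eq_intros time)
  then show "((\<lambda>t. \<integral>x. x * g t x \<partial>lborel) has_real_derivative - (\<integral>x. F t x \<partial>lborel)) (at t)"
    using integral_x_derivative[OF F h space, of t] by simp
qed

text \<open>
  By continuity the integrand exceeds half of its value at \<open>x0\<close> on an interval around \<open>x0\<close>.
\<close>

lemma integral_pos_of_continuous:
  fixes g :: "real \<Rightarrow> real"
  assumes int: "integrable lborel g" and cont: "continuous_on UNIV g"
    and nonneg: "\<And>x. 0 \<le> g x" and pos: "0 < g x0"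
  shows "0 < (\<integral>x. g x \<partial>lborel)"
proof -
  have "isCont g x0" using cont by (simp add: continuous_on_eq_continuous_at)
  then obtain d where d: "d > 0" "\<And>x. \<bar>x - x0\<bar> < d \<Longrightarrow> \<bar>g x - g x0\<bar> < g x0 / 2"
    using pos unfolding continuous_at_eps_delta dist_real_def by (metis half_gt_zero)
  define I where "I = {x0 - d/2..x0 + d/2}"
  have fin: "emeasure lborel I < \<infinity>" using d by (simp add: I_def)
  have "0 < g x0 / 2 * d" using pos d by simp
  also have "\<dots> = (\<integral>x. g x0 / 2 * indicator I x \<partial>lborel)"
    using d by (simp add: I_def)
  also have "\<dots> \<le> (\<integral>x. g x \<partial>lborel)"
  proof (rule integral_mono)
    show "integrable lborel (\<lambda>x. g x0 / 2 * indicator I x)"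
      using fin by (intro integrable_mult_right) (simp add: I_def)
    show "g x0 / 2 * indicator I x \<le> g x" for x
    proof (cases "x \<in> I")
      case True
      then have "\<bar>x - x0\<bar> \<le> d / 2" by (intro abs_leI) (auto simp: I_def)
      then have "\<bar>g x - g x0\<bar> < g x0 / 2" using d by (intro d(2)) linarith
      then have "g x0 / 2 \<le> g x" unfolding abs_less_iff by linarith
      then show ?thesis using True by simp
    qed (use nonneg in simp)
  qed (rule int)
  finally show ?thesis .
qed

text \<open>
  The centroid minus \<open>c\<close> is the average of \<open>x - c\<close>, so the triangle inequality for integrals applies.
\<close>

lemma centroid_distance_le:
  fixes g :: "real \<Rightarrow> real"
  assumes g: "integrable lborel g" and xg: "integrable lborel (\<lambda>x. x * g x)"
    and nonneg: "\<And>x. 0 \<le> g x" and pos: "0 < (\<integral>x. g x \<partial>lborel)"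
  shows "\<bar>1 / (\<integral>x. g x \<partial>lborel) * (\<integral>x. x * g x \<partial>lborel) - c\<bar>
    \<le> (\<integral>x. \<bar>x - c\<bar> * g x \<partial>lborel) / (\<integral>x. g x \<partial>lborel)"
proof -
  define m where "m = (\<integral>x. g x \<partial>lborel)"
  have "(\<integral>x. (x - c) * g x \<partial>lborel) = (\<integral>x. x * g x \<partial>lborel) - c * m"
    using g xg by (simp add: m_def left_diff_distrib)
  then have "1 / m * (\<integral>x. x * g x \<partial>lborel) - c = (\<integral>x. (x - c) * g x \<partial>lborel) / m"
    using pos by (simp add: m_def field_simps)
  moreover have "\<bar>\<integral>x. (x - c) * g x \<partial>lborel\<bar> \<le> (\<integral>x. \<bar>x - c\<bar> * g x \<partial>lborel)"
    using integral_abs_bound[of lborel "\<lambda>x. (x - c) * g x"] nonneg by (simp add: abs_mult)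
  ultimately show ?thesis
    using pos by (simp add: m_def divide_right_mono)
qed

section \<open>Derivatives of powers and of smooth functions\<close>

text \<open>
  Away from the origin this is the power rule; at the origin the difference quotient is
  \<open>|h|\<^sup>q\<close>, which tends to \<open>0\<close> since \<open>q > 0\<close>.
\<close>

lemma has_derivative_abs_powr_times:
  fixes y q :: real
  assumes "0 < q"
  shows "((\<lambda>y. \<bar>y\<bar> powr q * y) has_real_derivative (q + 1) * \<bar>y\<bar> powr q) (at y)"
proof -
  consider "y > 0" | "y < 0" | "y = 0" by linarith
  then show ?thesis
  proof cases
    case 1
    have "((\<lambda>y. y powr q * y) has_real_derivative (q + 1) * \<bar>y\<bar> powr q) (at y)"
      using 1 by (auto intro!: derivative_eq_intros simp: powr_diff field_simps)
    then show ?thesis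
      by (rule has_field_derivative_transform_within_open[where S="{0<..}"]) (use 1 in auto)
  next
    case 2
    have "((\<lambda>y. (- y) powr q * y) has_real_derivative (q + 1) * \<bar>y\<bar> powr q) (at y)"
      using 2 by (auto intro!: derivative_eq_intros simp: powr_diff field_simps)
    then show ?thesis
      by (rule has_field_derivative_transform_within_open[where S="{..<0}"]) (use 2 in auto)
  next
    case 3
    have "((\<lambda>h::real. \<bar>h\<bar> powr q) \<longlongrightarrow> \<bar>0\<bar> powr q) (at 0)"
      using assms by (intro tendsto_powr' tendsto_intros) auto
    then have "((\<lambda>h. (\<bar>0 + h\<bar> powr q * (0 + h) - \<bar>0\<bar> powr q * 0) / h) \<longlongrightarrow> \<bar>0\<bar> powr q) (at 0)"
      by (rule Lim_transform_eventually) (auto simp: eventually_at intro!: exI[of _ 1])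
    then show ?thesis using 3 assms by (simp add: DERIV_def)
  qed
qed

lemma smooth_has_derivatives:
  assumes u: "smooth u" and v: "v \<in> spacetime_derivatives u"
  shows "((\<lambda>s. v s x) has_real_derivative D_t v t x) (at t)"
    and "(v t has_real_derivative D_x v t x) (at x)"
    and "continuous_on UNIV (\<lambda>(t, x). v t x)"
proof -
  have d: "(\<lambda>(t, x). v t x) differentiable (at (t, x))"
    using u v by (simp add: smooth_def differentiable_on_def)
  have pair: "(\<lambda>s. (s, x)) differentiable (at t)" "(\<lambda>y. (t, y)) differentiable (at x)"
    unfolding differentiable_def by (auto intro!: derivative_eq_intros)
  have "((\<lambda>(t, x). v t x) \<circ> (\<lambda>s. (s, x))) differentiable (at t)"
    using pair d by (intro differentiable_chain_at)
  then show "((\<lambda>s. v s x) has_real_derivative D_t v t x) (at t)"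
    by (simp add: o_def D_t_def DERIV_deriv_iff_real_differentiable)
  have "((\<lambda>(t, x). v t x) \<circ> (\<lambda>y. (t, y))) differentiable (at x)"
    using pair d by (intro differentiable_chain_at)
  then show "(v t has_real_derivative D_x v t x) (at x)"
    by (simp add: o_def D_x_def DERIV_deriv_iff_real_differentiable)
  show "continuous_on UNIV (\<lambda>(t, x). v t x)"
    using u v unfolding smooth_def by (blast intro: differentiable_imp_continuous_on)
qed

text \<open>
  Write \<open>u s y = u s a + \<integral>\<^sub>a\<^sup>y u\<^sub>x s\<close> with a base point \<open>a < x\<close>, differentiate in \<open>s\<close> under the
  integral, and then differentiate the resulting formula for \<open>u\<^sub>t\<close> in \<open>y\<close>.
\<close>

lemma smooth_mixed_derivatives_commute:
  assumes u: "smooth u"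
  shows "D_t (D_x u) t x = D_x (D_t u) t x"
proof -
  note sd = spacetime_derivatives.intros
  define a where "a = x - 1"
  have cont: "continuous_on UNIV (v s)" if "v \<in> spacetime_derivatives u" for v s
    using smooth_has_derivatives(2)[OF u that]
    by (intro continuous_at_imp_continuous_on ballI DERIV_isCont)
  have ftc: "integral {a..y} (D_x u s) = u s y - u s a" if "a \<le> y" for s y
    by (rule integral_unique, rule fundamental_theorem_of_calculus[OF that])
       (use smooth_has_derivatives(2)[OF u sd(1)] in
         \<open>auto simp: has_real_derivative_iff_has_vector_derivative[symmetric]
           intro: has_field_derivative_at_within\<close>)
  have eq: "D_t u t a + integral {a..y} (D_t (D_x u) t) = D_t u t y" if "a \<le> y" for y
  proof -
    have "((\<lambda>s. integral (cbox a y) (D_x u s)) has_field_derivative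
        integral (cbox a y) (D_t (D_x u) t)) (at t within UNIV)"
    proof (rule leibniz_rule_field_derivative)
      show "((\<lambda>s. D_x u s z) has_field_derivative D_t (D_x u) s z) (at s within UNIV)" for s z
        using smooth_has_derivatives(1)[OF u sd(3)[OF sd(1)]] .
      show "D_x u s integrable_on cbox a y" for s
        by (rule integrable_continuous)
           (rule continuous_on_subset[OF cont[OF sd(3)[OF sd(1)]]], simp)
      show "continuous_on (UNIV \<times> cbox a y) (\<lambda>(x, z). D_t (D_x u) x z)"
        by (rule continuous_on_subset[OF smooth_has_derivatives(3)[OF u sd(2)[OF sd(3)[OF sd(1)]]]]) simp
    qed auto
    then have "((\<lambda>s. u s y - u s a) has_field_derivative integral {a..y} (D_t (D_x u) t)) (at t)"
      using ftc[OF that] by simp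
    moreover have "((\<lambda>s. u s y - u s a) has_field_derivative D_t u t y - D_t u t a) (at t)"
      by (intro derivative_intros smooth_has_derivatives(1)[OF u sd(1)])
    ultimately show ?thesis using DERIV_unique by fastforce
  qed
  have "((\<lambda>y. D_t u t a + integral {a..y} (D_t (D_x u) t)) has_field_derivative
      0 + D_t (D_x u) t x) (at x within {a..x + 1})"
    by (intro derivative_intros integral_has_real_derivative)
       (auto simp: a_def intro: continuous_on_subset[OF cont[OF sd(2)[OF sd(3)[OF sd(1)]]]])
  then have "((\<lambda>y. D_t u t a + integral {a..y} (D_t (D_x u) t)) has_field_derivative
      D_t (D_x u) t x) (at x)"
    by (subst (asm) at_within_interior) (auto simp: a_def)
  then have "(D_t u t has_field_derivative D_t (D_x u) t x) (at x)"
  proof (rule has_field_derivative_transform_within_open[where S="{a<..}"])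
    show "D_t u t a + integral {a..y} (D_t (D_x u) t) = D_t u t y" if "y \<in> {a<..}" for y
      using that by (intro eq) simp
  qed (auto simp: a_def)
  then show ?thesis
    using smooth_has_derivatives(2)[OF u sd(2)[OF sd(1)]] DERIV_unique by blast
qed

section \<open>Solutions and their conservation laws\<close>

locale gKdV_solution =
  fixes p :: real and u :: "real \<Rightarrow> real \<Rightarrow> real"
  assumes p: "p \<ge> sqrt 3"
    and solution: "global_schwartz_solution p u"
    and nontrivial: "\<exists>t x. u t x \<noteq> 0"
begin

text \<open>
  Up to sign, \<open>w\<close> is the flux of \<open>u\<close>: the equation says \<open>u\<^sub>t = - w\<^sub>x\<close>. The factor \<open>a\<close> makes
  \<open>f\<close>, its derivative \<open>p a u\<^sub>x\<close> and \<open>|u|\<^sup>p\<^sup>+\<^sup>1 = u f\<close> polynomial in the abbreviated functions.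
\<close>

abbreviation "ut \<equiv> D_t u"
abbreviation "ux \<equiv> D_x u"
abbreviation "uxx \<equiv> D_x (D_x u)"
abbreviation "a \<equiv> (\<lambda>t x. \<bar>u t x\<bar> powr (p - 1))"
definition "f t x = a t x * u t x"
abbreviation "w \<equiv> (\<lambda>t x. uxx t x - f t x)"

lemma p_gt_1: "p > 1"
proof -
  have "sqrt 1 < sqrt (3::real)" by (subst real_sqrt_less_iff) simp
  also note p
  finally show ?thesis by simp
qed

lemmas in_derivatives = spacetime_derivatives.intros

lemma smooth_u: "smooth u"
  using solution by (simp add: global_schwartz_solution_def)

lemma rapidly_decreasing_derivative:
  assumes "v \<in> spacetime_derivatives u"
  shows "rapidly_decreasing v"
  unfolding rapidly_decreasing_def
proof (intro conjI allI)
  show "continuous_on UNIV (v t)" for t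
    using smooth_has_derivatives(2)[OF smooth_u assms]
    by (intro continuous_at_imp_continuous_on ballI DERIV_isCont)
  have "schwartz_locally_uniformly v"
    using solution assms by (simp add: global_schwartz_solution_def)
  then have "\<exists>C. \<forall>t\<in>{s..t}. \<forall>x. \<bar>x\<bar> ^ j * \<bar>(D_x ^^ 0) v t x\<bar> \<le> C" for s t j
    unfolding schwartz_locally_uniformly_def by (meson compact_Icc)
  then show "\<exists>C. \<forall>t\<in>{s..t}. \<forall>x. \<bar>x\<bar> ^ j * \<bar>v t x\<bar> \<le> C" for s t j
    by simp
qed

lemma slab_bounded_a: "slab_bounded a"
  unfolding slab_bounded_def
proof (intro conjI allI)
  have u: "rapidly_decreasing u"
    by (intro rapidly_decreasing_derivative in_derivatives)
  show "continuous_on UNIV (a t)" for t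
    using rapidly_decreasing_continuous[OF u] p_gt_1
    by (intro continuous_on_powr' continuous_intros) auto
  fix s t
  obtain C where "\<And>r x. r \<in> {s..t} \<Longrightarrow> \<bar>u r x\<bar> \<le> C"
    using slab_bounded_bound[OF rapidly_decreasing_imp_slab_bounded[OF u]] by metis
  then have "\<forall>r\<in>{s..t}. \<forall>x. \<bar>a r x\<bar> \<le> C powr (p - 1)"
    using p_gt_1 by (auto intro!: powr_mono2)
  then show "\<exists>C. \<forall>r\<in>{s..t}. \<forall>x. \<bar>a r x\<bar> \<le> C" ..
qed

lemma rapid [intro!, simp]:
  "rapidly_decreasing u" "rapidly_decreasing ut" "rapidly_decreasing ux" "rapidly_decreasing uxx"
  "rapidly_decreasing (D_x ut)" "rapidly_decreasing (D_x uxx)" "rapidly_decreasing f"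
  unfolding f_def[abs_def]
  by (intro rapidly_decreasing_mult_bounded slab_bounded_a rapidly_decreasing_derivative
      in_derivatives)+

lemma rapid_a [intro!]: "rapidly_decreasing g \<Longrightarrow> rapidly_decreasing (\<lambda>t x. a t x * g t x)"
  by (intro rapidly_decreasing_mult_bounded slab_bounded_a)

lemma t_derivatives [derivative_intros]:
  "((\<lambda>t. u t x) has_real_derivative ut t x) (at t)"
  "((\<lambda>t. ux t x) has_real_derivative D_x ut t x) (at t)"
  using smooth_has_derivatives(1)[OF smooth_u in_derivatives(1)]
    smooth_has_derivatives(1)[OF smooth_u in_derivatives(3)[OF in_derivatives(1)]]
    smooth_mixed_derivatives_commute[OF smooth_u] by auto

lemma x_derivatives [derivative_intros]:
  "((\<lambda>x. u t x) has_real_derivative ux t x) (at x)"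
  "((\<lambda>x. ux t x) has_real_derivative uxx t x) (at x)"
  "((\<lambda>x. uxx t x) has_real_derivative D_x uxx t x) (at x)"
  "((\<lambda>x. ut t x) has_real_derivative D_x ut t x) (at x)"
  by (intro smooth_has_derivatives(2)[OF smooth_u] in_derivatives)+

lemma f_derivatives [derivative_intros]:
  "((\<lambda>x. f t x) has_real_derivative p * (a t x * ux t x)) (at x)"
  "((\<lambda>t. f t x) has_real_derivative p * (a t x * ut t x)) (at t)"
  using DERIV_chain2[OF has_derivative_abs_powr_times[of "p-1" "u t x"] x_derivatives(1)]
    DERIV_chain2[OF has_derivative_abs_powr_times[of "p-1" "u t x"] t_derivatives(1)]
    p_gt_1 by (simp_all add: f_def[abs_def] mult_ac)

lemma equation: "ut t x = p * (a t x * ux t x) - D_x uxx t x"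
proof -
  have "D_x f t x = p * (a t x * ux t x)"
    unfolding D_x_def[of f] by (rule DERIV_imp_deriv) (rule f_derivatives)
  moreover have "ut t x + D_x uxx t x = D_x f t x"
    using solution unfolding global_schwartz_solution_def gKdV_equation_def f_def[abs_def] by blast
  ultimately show ?thesis by simp
qed

text \<open>
  Although \<open>|u|\<^sup>p\<^sup>-\<^sup>1 u\<close> need not be twice differentiable, \<open>w\<close> is more regular
  than \<open>f\<close>: its derivative \<open>- u\<^sub>t\<close> is smooth. Every computation involving the
  energy flux therefore goes through \<open>w\<close>.
\<close>

lemma w_derivative: "((\<lambda>x. w t x) has_real_derivative - ut t x) (at x)"
  using DERIV_diff[OF x_derivatives(3) f_derivatives(1), of t t x] by (simp add: equation)

lemma energy_density_eq:
  "energy_density p u = (\<lambda>t x. 1/2 * (ux t x)\<^sup>2 + 1/(p + 1) * (u t x * f t x))"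
proof (intro ext)
  fix t x
  have "\<bar>u t x\<bar> powr (p + 1) = \<bar>u t x\<bar> powr (p - 1) * \<bar>u t x\<bar> powr 2"
    unfolding powr_add[symmetric] by (simp add: add.commute)
  also have "\<dots> = u t x * f t x"
    using powr_realpow'[of "\<bar>u t x\<bar>" 2] by (simp add: f_def power2_eq_square)
  finally show "energy_density p u t x = 1/2 * (ux t x)\<^sup>2 + 1/(p + 1) * (u t x * f t x)"
    by (simp add: energy_density_def)
qed

lemma rapid_densities:
  "rapidly_decreasing (mass_density u)" "rapidly_decreasing (energy_density p u)"
proof -
  have "mass_density u = (\<lambda>t x. (u t x)\<^sup>2)" by (intro ext) (simp add: mass_density_def)
  then show "rapidly_decreasing (mass_density u)" by (simp add: rapidly_decreasing_power2)
  show "rapidly_decreasing (energy_density p u)"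
    unfolding energy_density_eq by (intro rapidly_decreasing_intros rapid)
qed

definition "int_ux_sq t = (\<integral>x. (ux t x)\<^sup>2 \<partial>lborel)"
definition "int_u_f t = (\<integral>x. u t x * f t x \<partial>lborel)"
definition "int_uxx_sq t = (\<integral>x. (uxx t x)\<^sup>2 \<partial>lborel)"
definition "int_uxx_f t = (\<integral>x. uxx t x * f t x \<partial>lborel)"
definition "int_f_sq t = (\<integral>x. (f t x)\<^sup>2 \<partial>lborel)"

lemma integrable_pairs:
  "integrable lborel (\<lambda>x. (u t x)\<^sup>2)" "integrable lborel (\<lambda>x. (ux t x)\<^sup>2)"
  "integrable lborel (\<lambda>x. (uxx t x)\<^sup>2)" "integrable lborel (\<lambda>x. (f t x)\<^sup>2)"
  "integrable lborel (\<lambda>x. u t x * uxx t x)" "integrable lborel (\<lambda>x. u t x * f t x)"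
  "integrable lborel (\<lambda>x. uxx t x * f t x)" "integrable lborel (\<lambda>x. ux t x * ut t x)"
  by (rule rapidly_decreasing_integrable, intro rapidly_decreasing_intros rapid)+

lemma integral_u_uxx: "(\<integral>x. u t x * uxx t x \<partial>lborel) = - int_ux_sq t"
  using integral_by_parts[of u ux ux uxx t]
  by (simp add: int_ux_sq_def power2_eq_square rapidly_decreasing_mult x_derivatives)

text \<open>
  Integration by parts gives \<open>\<integral>u\<^sub>x\<^sub>x f = - p \<integral>|u|\<^sup>p\<^sup>-\<^sup>1 u\<^sub>x\<^sup>2\<close>. The sign reflects that the equation
  is defocusing.
\<close>

lemma int_uxx_f_nonpos: "int_uxx_f t \<le> 0"
proof -
  have "(\<integral>x. f t x * uxx t x \<partial>lborel) = - (\<integral>x. p * (a t x * ux t x) * ux t x \<partial>lborel)"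
    by (rule integral_by_parts) (intro rapidly_decreasing_intros rapid rapid_a f_derivatives x_derivatives)+
  moreover have "0 \<le> (\<integral>x. p * (a t x * ux t x) * ux t x \<partial>lborel)"
    using p_gt_1 by (intro integral_nonneg_AE) (simp add: mult.assoc)
  ultimately show ?thesis by (simp add: int_uxx_f_def mult.commute)
qed

text \<open>
  As \<open>u\<^sub>t = - w\<^sub>x\<close>, the left-hand side is \<open>- \<integral>u\<^sub>x w\<^sub>x = \<integral>u\<^sub>x\<^sub>x w\<close>.
\<close>

lemma integral_ux_ut: "(\<integral>x. ux t x * ut t x \<partial>lborel) = int_uxx_sq t - int_uxx_f t"
proof -
  have "(\<integral>x. ux t x * - ut t x \<partial>lborel) = - (\<integral>x. uxx t x * w t x \<partial>lborel)"
  proof (rule integral_by_parts)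
    show "rapidly_decreasing (\<lambda>t x. ux t x * - ut t x)"
      using rapidly_decreasing_cmult[OF rapidly_decreasing_mult[OF rapid(3) rapid(2)], of "-1"] by simp
  qed (intro rapidly_decreasing_intros rapid x_derivatives w_derivative)+
  then show ?thesis
    using integrable_pairs[of t] by (simp add: int_uxx_sq_def int_uxx_f_def power2_eq_square right_diff_distrib)
qed

text \<open>
  The flux is \<open>u\<^sub>x\<^sup>2 - 2 u u\<^sub>x\<^sub>x + 2p/(p+1) u f\<close>; its first two terms contribute
  \<open>3 \<integral>u\<^sub>x\<^sup>2\<close> to its integral, because \<open>\<integral>u u\<^sub>x\<^sub>x = - \<integral>u\<^sub>x\<^sup>2\<close>.
\<close>

lemma mass_conservation:
  shows "(mass u has_real_derivative 0) (at t)"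
    and "((\<lambda>t. \<integral>x. x * mass_density u t x \<partial>lborel) has_real_derivative
           - (3 * int_ux_sq t + 2 * p / (p + 1) * int_u_f t)) (at t)"
proof -
  let ?F = "\<lambda>t x. (ux t x)\<^sup>2 - 2 * (u t x * uxx t x) + 2 * p / (p + 1) * (u t x * f t x)"
  let ?h = "\<lambda>t x. 2 * (u t x * ut t x)"
  have F: "rapidly_decreasing ?F" and h: "rapidly_decreasing ?h"
    by (intro rapidly_decreasing_intros rapid)+
  have time: "((\<lambda>t. mass_density u t x) has_real_derivative ?h t x) (at t)" for t x
    unfolding mass_density_def by (auto intro!: derivative_eq_intros t_derivatives)
  have space: "(?F t has_real_derivative ?h t x) (at x)" for t x
  proof (rule DERIV_cong)
    show "(?F t has_real_derivative 2 * (ux t x * uxx t x) - 2 * (ux t x * uxx t x + u t x * D_x uxx t x)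
        + 2 * p / (p + 1) * (ux t x * f t x + u t x * (p * (a t x * ux t x)))) (at x)"
      using p_gt_1 by (auto intro!: derivative_eq_intros x_derivatives f_derivatives)
    show "2 * (ux t x * uxx t x) - 2 * (ux t x * uxx t x + u t x * D_x uxx t x)
        + 2 * p / (p + 1) * (ux t x * f t x + u t x * (p * (a t x * ux t x))) = ?h t x"
      by (simp add: equation f_def divide_simps; use p_gt_1 in \<open>simp add: algebra_simps\<close>)
  qed
  note cl = conservation_law[OF rapid_densities(1) F h time space, of t]
  show "(mass u has_real_derivative 0) (at t)"
    using cl(1) by (simp add: mass_def[abs_def])
  have "(\<integral>x. ?F t x \<partial>lborel) = 3 * int_ux_sq t + 2 * p / (p + 1) * int_u_f t"
    using integrable_pairs[of t] integral_u_uxx[of t] by (simp add: int_ux_sq_def int_u_f_def)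
  then show "((\<lambda>t. \<integral>x. x * mass_density u t x \<partial>lborel) has_real_derivative
           - (3 * int_ux_sq t + 2 * p / (p + 1) * int_u_f t)) (at t)"
    using cl(2) by simp
qed

text \<open>
  Since \<open>e\<^sub>t = u\<^sub>x u\<^sub>t\<^sub>x + f u\<^sub>t\<close> and \<open>f = u\<^sub>x\<^sub>x - w\<close>, the flux is \<open>u\<^sub>x u\<^sub>t + w\<^sup>2/2\<close>: its
  derivative is \<open>u\<^sub>x\<^sub>x u\<^sub>t + u\<^sub>x u\<^sub>t\<^sub>x - w u\<^sub>t\<close>.
\<close>

lemma energy_conservation:
  shows "(energy p u has_real_derivative 0) (at t)"
    and "((\<lambda>t. \<integral>x. x * energy_density p u t x \<partial>lborel) has_real_derivative
           - (3/2 * int_uxx_sq t - 2 * int_uxx_f t + 1/2 * int_f_sq t)) (at t)"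
proof -
  let ?F = "\<lambda>t x. ux t x * ut t x + 1/2 * (w t x)\<^sup>2"
  let ?h = "\<lambda>t x. ux t x * D_x ut t x + f t x * ut t x"
  have F: "rapidly_decreasing ?F" and h: "rapidly_decreasing ?h"
    by (intro rapidly_decreasing_intros rapid)+
  have time: "((\<lambda>t. energy_density p u t x) has_real_derivative ?h t x) (at t)" for t x
    unfolding energy_density_eq
  proof (rule DERIV_cong)
    show "((\<lambda>t. 1/2 * (ux t x)\<^sup>2 + 1/(p + 1) * (u t x * f t x)) has_real_derivative
        ux t x * D_x ut t x + 1/(p + 1) * (ut t x * f t x + u t x * (p * (a t x * ut t x)))) (at t)"
      using p_gt_1 by (auto intro!: derivative_eq_intros t_derivatives f_derivatives)
    show "ux t x * D_x ut t x + 1/(p + 1) * (ut t x * f t x + u t x * (p * (a t x * ut t x))) = ?h t x"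
      by (simp add: f_def divide_simps; use p_gt_1 in \<open>simp add: algebra_simps\<close>)
  qed
  have space: "(?F t has_real_derivative ?h t x) (at x)" for t x
    by (rule DERIV_cong[OF DERIV_add[OF DERIV_mult[OF x_derivatives(2) x_derivatives(4)]
          DERIV_cmult[OF DERIV_power[where n=2, OF w_derivative]]]]) (simp add: algebra_simps)
  note cl = conservation_law[OF rapid_densities(2) F h time space, of t]
  show "(energy p u has_real_derivative 0) (at t)"
    using cl(1) by (simp add: energy_def[abs_def])
  have "(\<integral>x. ?F t x \<partial>lborel)
      = (\<integral>x. ux t x * ut t x + (1/2 * (uxx t x)\<^sup>2 - uxx t x * f t x + 1/2 * (f t x)\<^sup>2) \<partial>lborel)"
    by (intro Bochner_Integration.integral_cong) (auto simp: power2_diff field_simps)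
  also have "\<dots> = 3/2 * int_uxx_sq t - 2 * int_uxx_f t + 1/2 * int_f_sq t"
    using integrable_pairs[of t] by (simp add: integral_ux_ut int_uxx_sq_def int_uxx_f_def int_f_sq_def)
  finally show "((\<lambda>t. \<integral>x. x * energy_density p u t x \<partial>lborel) has_real_derivative
           - (3/2 * int_uxx_sq t - 2 * int_uxx_f t + 1/2 * int_f_sq t)) (at t)"
    using cl(2) by simp
qed

lemma mass_const: "mass u t = mass u s"
  using mass_conservation(1) by (intro DERIV_isconst_all) blast

lemma energy_const: "energy p u t = energy p u s"
  using energy_conservation(1) by (intro DERIV_isconst_all) blast

text \<open>
  Nontriviality at one time is carried to every other time by conservation of mass.
\<close>

lemma mass_pos: "0 < mass u t"
proof -
  obtain s x where "u s x \<noteq> 0" using nontrivial by blast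
  then have "0 < mass u s"
    unfolding mass_def
    by (intro integral_pos_of_continuous[where ?x0.0=x] rapidly_decreasing_integrable
          rapidly_decreasing_continuous rapid_densities) (auto simp: mass_density_def)
  then show ?thesis using mass_const[of t s] by simp
qed

lemma int_u_f_pos: "0 < int_u_f t"
proof -
  have "\<exists>x. u t x \<noteq> 0"
  proof (rule ccontr)
    assume "\<nexists>x. u t x \<noteq> 0"
    then have "mass u t = 0" by (simp add: mass_def mass_density_def)
    then show False using mass_pos[of t] by simp
  qed
  then obtain x where x: "u t x \<noteq> 0" ..
  have "rapidly_decreasing (\<lambda>t x. u t x * f t x)" by (intro rapidly_decreasing_intros rapid)
  then show ?thesis
    unfolding int_u_f_def using x
    by (intro integral_pos_of_continuous[where ?x0.0=x] rapidly_decreasing_integrable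
          rapidly_decreasing_continuous[of "\<lambda>t x. u t x * f t x"])
       (auto simp: f_def mult.left_commute[of "u _ _"] simp flip: power2_eq_square)
qed

lemma int_ux_sq_nonneg: "0 \<le> int_ux_sq t"
  unfolding int_ux_sq_def by (intro integral_nonneg_AE) simp

lemma energy_eq: "energy p u t = int_ux_sq t / 2 + int_u_f t / (p + 1)"
  unfolding energy_def energy_density_eq using integrable_pairs[of t]
  by (simp add: int_ux_sq_def int_u_f_def)

lemma energy_pos: "0 < energy p u t"
  unfolding energy_eq using int_ux_sq_nonneg[of t] int_u_f_pos[of t] p_gt_1
  by (intro add_nonneg_pos divide_pos_pos) auto

section \<open>Comparison of the two speeds\<close>

text \<open>
  The inequality \<open>\<langle>u, g\<rangle>\<^sup>2 \<le> \<parallel>u\<parallel>\<^sup>2 \<parallel>g\<parallel>\<^sup>2\<close> for \<open>g = \<surd>3 u\<^sub>x\<^sub>x - f\<close>, proved by expanding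
  \<open>\<parallel>g + s u\<parallel>\<^sup>2 \<ge> 0\<close> at the minimising \<open>s = - \<langle>u, g\<rangle> / \<parallel>u\<parallel>\<^sup>2\<close>. This choice of \<open>g\<close> produces the
  coefficients \<open>3/2\<close> and \<open>1/2\<close> of the energy flux.
\<close>

lemma cauchy_schwarz:
  "(sqrt 3 * int_ux_sq t + int_u_f t)\<^sup>2 \<le> mass u t * (3 * int_uxx_sq t - 2 * sqrt 3 * int_uxx_f t + int_f_sq t)"
proof -
  define s where "s = (sqrt 3 * int_ux_sq t + int_u_f t) / mass u t"
  have "0 \<le> (\<integral>x. (sqrt 3 * uxx t x - f t x + s * u t x)\<^sup>2 \<partial>lborel)"
    by (intro integral_nonneg_AE) simp
  also have "\<dots> = (\<integral>x. 3 * (uxx t x)\<^sup>2 - 2 * sqrt 3 * (uxx t x * f t x) + (f t x)\<^sup>2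
      + (2 * s * (sqrt 3 * (u t x * uxx t x) - u t x * f t x) + s\<^sup>2 * (u t x)\<^sup>2) \<partial>lborel)"
    by (intro Bochner_Integration.integral_cong refl)
       (simp add: power2_eq_square algebra_simps)
  also have "\<dots> = 3 * int_uxx_sq t - 2 * sqrt 3 * int_uxx_f t + int_f_sq t - 2 * s * (sqrt 3 * int_ux_sq t + int_u_f t) + s\<^sup>2 * mass u t"
    using integrable_pairs[of t] integral_u_uxx[of t]
    by (simp add: int_uxx_sq_def int_uxx_f_def int_f_sq_def int_u_f_def mass_def mass_density_def) (simp add: algebra_simps)
  also have "\<dots> = 3 * int_uxx_sq t - 2 * sqrt 3 * int_uxx_f t + int_f_sq t - (sqrt 3 * int_ux_sq t + int_u_f t)\<^sup>2 / mass u t"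
    using mass_pos[of t] by (simp add: s_def power2_eq_square field_simps)
  finally show ?thesis using mass_pos[of t] by (simp add: field_simps)
qed

text \<open>
  The gap \<open>1/2 - 2p/(p+1)\<^sup>2\<close> between the coefficients of \<open>(\<integral>u f)\<^sup>2\<close> in half of the
  Cauchy-Schwarz square and in the product of the energy with the mass flux.
\<close>

definition "\<kappa> = (p - 1)\<^sup>2 / (2 * (p + 1)\<^sup>2)"

text \<open>
  Since \<open>E = \<integral>u\<^sub>x\<^sup>2/2 + \<integral>u f/(p+1)\<close>, the left-hand side is a quadratic form in \<open>\<integral>u\<^sub>x\<^sup>2\<close> and
  \<open>\<integral>u f\<close> that differs from half of the Cauchy-Schwarz square only in its cross term: the
  coefficient is \<open>(p+3)/(p+1)\<close> instead of \<open>\<surd>3\<close>. The condition \<open>(p+3)/(p+1) \<le> \<surd>3\<close> is equivalent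
  to \<open>p \<ge> \<surd>3\<close>.
\<close>

lemma key_inequality:
  "energy p u t * (3 * int_ux_sq t + 2 * p / (p + 1) * int_u_f t) + \<kappa> * (int_u_f t)\<^sup>2
     \<le> mass u t * (3/2 * int_uxx_sq t - 2 * int_uxx_f t + 1/2 * int_f_sq t)"
proof -
  have "sqrt 3 \<le> sqrt (2\<^sup>2::real)" by (subst real_sqrt_le_iff) simp
  then have s2: "sqrt 3 \<le> (2::real)" by simp
  have coeff: "(p + 3) / (p + 1) \<le> sqrt 3"
  proof -
    have "0 \<le> (sqrt 3 - 1) * (p - sqrt 3)" using p by (intro mult_nonneg_nonneg) auto
    also have "\<dots> = sqrt 3 * (p + 1) - (p + 3)" by (simp add: algebra_simps)
    finally show ?thesis using p_gt_1 by (simp add: field_simps)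
  qed
  have "energy p u t * (3 * int_ux_sq t + 2 * p / (p + 1) * int_u_f t) + \<kappa> * (int_u_f t)\<^sup>2
      = 3/2 * (int_ux_sq t)\<^sup>2 + (p + 3) / (p + 1) * (int_ux_sq t * int_u_f t) + 1/2 * (int_u_f t)\<^sup>2"
  proof -
    \<comment> \<open>In terms of \<open>r\<close>, with \<open>r p = 1 - r\<close>, the identity is polynomial.\<close>
    define r where "r = 1 / (p + 1)"
    have r: "r * p = 1 - r" using p_gt_1 by (simp add: r_def field_simps)
    have "r * p - r = (p - 1) / (p + 1)" by (simp add: r_def diff_divide_distrib)
    then have k: "\<kappa> = (r * p - r)\<^sup>2 / 2"
      by (simp add: \<kappa>_def power_divide)
    have c: "(p + 3) / (p + 1) = r * p + 3 * r" and d: "2 * p / (p + 1) = 2 * (r * p)"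
      and e: "energy p u t = int_ux_sq t / 2 + r * int_u_f t"
      by (simp_all add: r_def energy_eq add_divide_distrib)
    show ?thesis unfolding k c d e r by (simp add: power2_eq_square field_simps)
  qed
  also have "\<dots> \<le> 3/2 * (int_ux_sq t)\<^sup>2 + sqrt 3 * (int_ux_sq t * int_u_f t) + 1/2 * (int_u_f t)\<^sup>2"
    using coeff int_ux_sq_nonneg[of t] int_u_f_pos[of t]
    by (intro add_right_mono add_left_mono mult_right_mono) auto
  also have "\<dots> = 1/2 * (sqrt 3 * int_ux_sq t + int_u_f t)\<^sup>2"
    by (simp add: power2_sum power_mult_distrib field_simps)
  also have "\<dots> \<le> 1/2 * (mass u t * (3 * int_uxx_sq t - 2 * sqrt 3 * int_uxx_f t + int_f_sq t))"
    using cauchy_schwarz[of t] by simp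
  also have "\<dots> = mass u t * (3/2 * int_uxx_sq t - sqrt 3 * int_uxx_f t + 1/2 * int_f_sq t)" by (simp add: field_simps)
  also have "\<dots> \<le> mass u t * (3/2 * int_uxx_sq t - 2 * int_uxx_f t + 1/2 * int_f_sq t)"
  proof (intro mult_left_mono)
    have "2 * int_uxx_f t \<le> sqrt 3 * int_uxx_f t" using s2 int_uxx_f_nonpos[of t] by (intro mult_right_mono_neg) auto
    then show "3/2 * int_uxx_sq t - sqrt 3 * int_uxx_f t + 1/2 * int_f_sq t \<le> 3/2 * int_uxx_sq t - 2 * int_uxx_f t + 1/2 * int_f_sq t" by simp
  qed (use mass_pos[of t] in simp)
  finally show ?thesis .
qed

lemma centre_of_mass_derivative:
  "(centre_of_mass u has_real_derivative
     - (3 * int_ux_sq t + 2 * p / (p + 1) * int_u_f t) / mass u t) (at t)"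
proof -
  have "centre_of_mass u = (\<lambda>s. 1 / mass u t * (\<integral>x. x * mass_density u s x \<partial>lborel))"
  proof
    show "centre_of_mass u s = 1 / mass u t * (\<integral>x. x * mass_density u s x \<partial>lborel)" for s
      unfolding centre_of_mass_def using mass_const[of s t] by simp
  qed
  then show ?thesis
    using DERIV_cmult[OF mass_conservation(2)[of t], of "1 / mass u t"] by simp
qed

lemma centre_of_energy_derivative:
  "(centre_of_energy p u has_real_derivative
     - (3/2 * int_uxx_sq t - 2 * int_uxx_f t + 1/2 * int_f_sq t) / energy p u t) (at t)"
proof -
  have "centre_of_energy p u = (\<lambda>s. 1 / energy p u t * (\<integral>x. x * energy_density p u s x \<partial>lborel))"
  proof
    show "centre_of_energy p u s = 1 / energy p u t * (\<integral>x. x * energy_density p u s x \<partial>lborel)" for s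
      unfolding centre_of_energy_def using energy_const[of s t] by simp
  qed
  then show ?thesis
    using DERIV_cmult[OF energy_conservation(2)[of t], of "1 / energy p u t"] by simp
qed

lemma separation_speed:
  "deriv (centre_of_mass u) t - deriv (centre_of_energy p u) t
     \<ge> \<kappa> * (int_u_f t)\<^sup>2 / (mass u t * energy p u t)"
proof -
  define R where "R = 3/2 * int_uxx_sq t - 2 * int_uxx_f t + 1/2 * int_f_sq t"
  define Q where "Q = 3 * int_ux_sq t + 2 * p / (p + 1) * int_u_f t"
  have "energy p u t * Q + \<kappa> * (int_u_f t)\<^sup>2 \<le> mass u t * R"
    using key_inequality[of t] by (simp add: R_def Q_def)
  then have "\<kappa> * (int_u_f t)\<^sup>2 / (mass u t * energy p u t) \<le> - Q / mass u t - - R / energy p u t"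
    using mass_pos[of t] energy_pos[of t] by (simp add: field_simps)
  then show ?thesis
    using DERIV_imp_deriv[OF centre_of_mass_derivative[of t]]
      DERIV_imp_deriv[OF centre_of_energy_derivative[of t]] by (simp add: R_def Q_def)
qed

lemma \<kappa>_pos: "0 < \<kappa>"
  using p_gt_1 by (auto simp: \<kappa>_def intro!: divide_pos_pos)

lemma separation_speed_pos:
  "deriv (centre_of_mass u) t - deriv (centre_of_energy p u) t > 0"
proof -
  have "0 < \<kappa> * (int_u_f t)\<^sup>2 / (mass u t * energy p u t)"
    using \<kappa>_pos int_u_f_pos[of t] mass_pos[of t] energy_pos[of t] by simp
  then show ?thesis using separation_speed[of t] by linarith
qed

lemma separation_derivative:
  "((\<lambda>t. centre_of_mass u t - centre_of_energy p u t) has_real_derivative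
     deriv (centre_of_mass u) t - deriv (centre_of_energy p u) t) (at t)"
  using centre_of_mass_derivative[of t] centre_of_energy_derivative[of t]
  by (intro DERIV_diff) (simp_all add: DERIV_imp_deriv)

lemma densities_nonneg: "0 \<le> mass_density u t x" "0 \<le> energy_density p u t x"
  using p_gt_1 by (simp_all add: mass_density_def energy_density_def)

lemma integrable_distance_times:
  assumes "rapidly_decreasing g"
  shows "integrable lborel (\<lambda>x. \<bar>x - c\<bar> * \<bar>g t x\<bar>)"
proof -
  have "rapidly_decreasing (\<lambda>t x. x * g t x - c * g t x)"
    by (intro rapidly_decreasing_intros assms)
  then have "integrable lborel (\<lambda>x. \<bar>x * g t x - c * g t x\<bar>)"
    by (intro integrable_abs rapidly_decreasing_integrable[of "\<lambda>t x. x * g t x - c * g t x"])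
  then show ?thesis by (simp add: left_diff_distrib flip: abs_mult)
qed

section \<open>Solutions do not stay localised\<close>

lemma confined_moments:
  assumes "(\<integral>\<^sup>+x. ennreal (\<bar>x - c\<bar> * (mass_density u t x + energy_density p u t x)) \<partial>lborel)
      \<le> ennreal K" and "0 \<le> K"
  shows "(\<integral>x. \<bar>x - c\<bar> * mass_density u t x \<partial>lborel) \<le> K"
    and "(\<integral>x. \<bar>x - c\<bar> * energy_density p u t x \<partial>lborel) \<le> K"
proof -
  have int: "integrable lborel (\<lambda>x. \<bar>x - c\<bar> * mass_density u t x)"
    "integrable lborel (\<lambda>x. \<bar>x - c\<bar> * energy_density p u t x)"
    using integrable_distance_times[OF rapid_densities(1), of c t]
      integrable_distance_times[OF rapid_densities(2), of c t] densities_nonneg by simp_all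
  have "integrable lborel (\<lambda>x. \<bar>x - c\<bar> * (mass_density u t x + energy_density p u t x))"
    using int by (simp add: distrib_left)
  then have "(\<integral>x. \<bar>x - c\<bar> * (mass_density u t x + energy_density p u t x) \<partial>lborel) \<le> K"
    using assms densities_nonneg by (subst (asm) nn_integral_eq_integral) auto
  then have "(\<integral>x. \<bar>x - c\<bar> * mass_density u t x \<partial>lborel)
      + (\<integral>x. \<bar>x - c\<bar> * energy_density p u t x \<partial>lborel) \<le> K"
    using int by (simp add: distrib_left)
  moreover have "0 \<le> (\<integral>x. \<bar>x - c\<bar> * mass_density u t x \<partial>lborel)"
    "0 \<le> (\<integral>x. \<bar>x - c\<bar> * energy_density p u t x \<partial>lborel)"
    using densities_nonneg by (auto intro!: integral_nonneg_AE)
  ultimately show "(\<integral>x. \<bar>x - c\<bar> * mass_density u t x \<partial>lborel) \<le> K"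
    "(\<integral>x. \<bar>x - c\<bar> * energy_density p u t x \<partial>lborel) \<le> K" by linarith+
qed

text \<open>
  A pointwise substitute for Hoelder's inequality. The mass at distance at least \<open>R\<close> from \<open>c\<close> is
  controlled by the first moment. Within distance \<open>R\<close>, the points where \<open>|u| \<le> \<eta>\<close> contribute at
  most \<open>2 R \<eta>\<^sup>2\<close>, and elsewhere \<open>u\<^sup>2 \<le> \<eta>\<^sup>1\<^sup>-\<^sup>p |u|\<^sup>p\<^sup>+\<^sup>1\<close>.
\<close>

lemma mass_le_local:
  assumes R: "0 < R" and eta: "0 < \<eta>"
  shows "mass u t \<le> (\<integral>x. \<bar>x - c\<bar> * mass_density u t x \<partial>lborel) / R
    + 2 * R * \<eta>\<^sup>2 + \<eta> powr (1 - p) * int_u_f t"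
proof -
  let ?I = "{c - R..c + R}"
  have pointwise: "mass_density u t x \<le> \<bar>x - c\<bar> * mass_density u t x / R + \<eta>\<^sup>2 * indicator ?I x
      + \<eta> powr (1 - p) * (u t x * f t x)" for x
  proof -
    have uf: "u t x * f t x = a t x * (u t x)\<^sup>2" by (simp add: f_def power2_eq_square)
    have n: "0 \<le> \<bar>x - c\<bar> * mass_density u t x / R" "0 \<le> \<eta>\<^sup>2 * indicator ?I x"
      "0 \<le> \<eta> powr (1 - p) * (u t x * f t x)"
      using R densities_nonneg by (simp_all add: uf)
    consider "x \<notin> ?I" | "x \<in> ?I" "\<bar>u t x\<bar> \<le> \<eta>" | "\<bar>u t x\<bar> > \<eta>" by linarith
    then show ?thesis
    proof cases
      case 1
      then have "R \<le> \<bar>x - c\<bar>" by auto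
      then have "1 * mass_density u t x \<le> \<bar>x - c\<bar> / R * mass_density u t x"
        using R densities_nonneg by (intro mult_right_mono) auto
      then have "mass_density u t x \<le> \<bar>x - c\<bar> * mass_density u t x / R" by simp
      then show ?thesis using n by linarith
    next
      case 2
      then have "mass_density u t x \<le> \<eta>\<^sup>2"
        using power_mono[of "\<bar>u t x\<bar>" \<eta> 2] by (simp add: mass_density_def)
      then show ?thesis using n 2 by simp
    next
      case 3
      have "1 = \<eta> powr (1 - p) * \<eta> powr (p - 1)"
        using eta by (simp flip: powr_add)
      also have "\<dots> \<le> \<eta> powr (1 - p) * a t x"
        using 3 eta p_gt_1 by (intro mult_left_mono powr_mono2) auto
      finally have "1 * (u t x)\<^sup>2 \<le> \<eta> powr (1 - p) * a t x * (u t x)\<^sup>2"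
        by (intro mult_right_mono) auto
      then have "mass_density u t x \<le> \<eta> powr (1 - p) * (u t x * f t x)"
        by (simp add: uf mass_density_def mult.assoc)
      then show ?thesis using n by linarith
    qed
  qed
  have int: "integrable lborel (\<lambda>x. \<bar>x - c\<bar> * mass_density u t x)"
    using integrable_distance_times[OF rapid_densities(1), of c t] densities_nonneg by simp
  have int_I: "integrable lborel (\<lambda>x. \<eta>\<^sup>2 * indicator ?I x)"
    using R by (intro integrable_mult_right) (simp add: emeasure_lborel_Icc)
  have I: "(\<integral>x. indicator ?I x \<partial>lborel) = 2 * R"
    using R by simp
  have "mass u t \<le> (\<integral>x. \<bar>x - c\<bar> * mass_density u t x / R + \<eta>\<^sup>2 * indicator ?I x
      + \<eta> powr (1 - p) * (u t x * f t x) \<partial>lborel)"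
    unfolding mass_def
  proof (rule integral_mono)
    show "integrable lborel (mass_density u t)"
      by (rule rapidly_decreasing_integrable) (rule rapid_densities)
    show "integrable lborel (\<lambda>x. \<bar>x - c\<bar> * mass_density u t x / R + \<eta>\<^sup>2 * indicator ?I x
        + \<eta> powr (1 - p) * (u t x * f t x))"
      by (intro Bochner_Integration.integrable_add integrable_divide integrable_mult_right int int_I
          integrable_pairs)
  qed (rule pointwise)
  also have "\<dots> = (\<integral>x. \<bar>x - c\<bar> * mass_density u t x / R \<partial>lborel)
      + (\<integral>x. \<eta>\<^sup>2 * indicator ?I x \<partial>lborel) + (\<integral>x. \<eta> powr (1 - p) * (u t x * f t x) \<partial>lborel)"
    by (simp only: Bochner_Integration.integral_add Bochner_Integration.integrable_add
        integrable_divide[OF int] int_I integrable_mult_right[OF integrable_pairs(6)])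
  also have "\<dots> = (\<integral>x. \<bar>x - c\<bar> * mass_density u t x \<partial>lborel) / R
      + 2 * R * \<eta>\<^sup>2 + \<eta> powr (1 - p) * int_u_f t"
    unfolding integral_divide_zero integral_mult_right_zero I int_u_f_def by simp
  finally show ?thesis .
qed

text \<open>
  The point is that \<open>b\<close> depends on neither \<open>t\<close> nor \<open>c\<close>. The radius \<open>R\<close> and the level \<open>\<eta>\<close> are chosen
  so that the first two terms of \<open>mass_le_local\<close> are at most a quarter of the mass each.
\<close>

lemma int_u_f_lower_bound_if_confined:
  assumes "0 < K"
  obtains b where "0 < b" and
    "\<And>t c. (\<integral>x. \<bar>x - c\<bar> * mass_density u t x \<partial>lborel) \<le> K \<Longrightarrow> b \<le> int_u_f t"
proof -
  define m where "m = mass u 0"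
  have m: "0 < m" using mass_pos by (simp add: m_def)
  define R where "R = 4 * K / m"
  define \<eta> where "\<eta> = sqrt (m / (8 * R))"
  have R: "0 < R" using m assms by (simp add: R_def)
  then have eta: "0 < \<eta>" "2 * R * \<eta>\<^sup>2 = m / 4" using m by (simp_all add: \<eta>_def)
  define b where "b = m / 2 * \<eta> powr (p - 1)"
  show thesis
  proof (rule that)
    show "0 < b" using m eta by (simp add: b_def)
    fix t c assume K: "(\<integral>x. \<bar>x - c\<bar> * mass_density u t x \<partial>lborel) \<le> K"
    have "m \<le> (\<integral>x. \<bar>x - c\<bar> * mass_density u t x \<partial>lborel) / R + m / 4 + \<eta> powr (1 - p) * int_u_f t"
      using mass_le_local[OF R eta(1), of t c] mass_const[of 0 t] by (simp add: m_def[symmetric] eta)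
    also have "(\<integral>x. \<bar>x - c\<bar> * mass_density u t x \<partial>lborel) / R \<le> K / R"
      using K R by (intro divide_right_mono) auto
    also have "K / R = m / 4" using m assms by (simp add: R_def)
    finally have "m / 2 \<le> \<eta> powr (1 - p) * int_u_f t" by simp
    then have "m / 2 * \<eta> powr (p - 1) \<le> \<eta> powr (1 - p) * int_u_f t * \<eta> powr (p - 1)"
      by (intro mult_right_mono) auto
    also have "\<dots> = (\<eta> powr (1 - p) * \<eta> powr (p - 1)) * int_u_f t" by simp
    also have "\<eta> powr (1 - p) * \<eta> powr (p - 1) = 1" using eta by (simp flip: powr_add)
    finally show "b \<le> int_u_f t" by (simp add: b_def)
  qed
qed

lemma centres_close_if_confined:
  assumes "(\<integral>x. \<bar>x - c\<bar> * mass_density u t x \<partial>lborel) \<le> K"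
    and "(\<integral>x. \<bar>x - c\<bar> * energy_density p u t x \<partial>lborel) \<le> K"
  shows "\<bar>centre_of_mass u t - centre_of_energy p u t\<bar> \<le> K / mass u 0 + K / energy p u 0"
proof -
  have "\<bar>centre_of_mass u t - c\<bar> \<le> (\<integral>x. \<bar>x - c\<bar> * mass_density u t x \<partial>lborel) / mass u t"
    unfolding centre_of_mass_def mass_def using mass_pos[of t]
    by (intro centroid_distance_le rapidly_decreasing_integrable rapid_densities densities_nonneg
        rapidly_decreasing_integrable[of "\<lambda>t x. x * mass_density u t x"] rapidly_decreasing_mult_x)
      (simp add: mass_def)
  also have "\<dots> \<le> K / mass u t"
    using assms mass_pos[of t] by (intro divide_right_mono) auto
  finally have 1: "\<bar>centre_of_mass u t - c\<bar> \<le> K / mass u t" .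
  have "\<bar>centre_of_energy p u t - c\<bar> \<le> (\<integral>x. \<bar>x - c\<bar> * energy_density p u t x \<partial>lborel) / energy p u t"
    unfolding centre_of_energy_def energy_def using energy_pos[of t]
    by (intro centroid_distance_le rapidly_decreasing_integrable rapid_densities densities_nonneg
        rapidly_decreasing_integrable[of "\<lambda>t x. x * energy_density p u t x"] rapidly_decreasing_mult_x)
      (simp add: energy_def)
  also have "\<dots> \<le> K / energy p u t"
    using assms energy_pos[of t] by (intro divide_right_mono) auto
  finally have "\<bar>centre_of_energy p u t - c\<bar> \<le> K / energy p u t" .
  with 1 show ?thesis
    unfolding mass_const[of t 0] energy_const[of t 0] by linarith
qed

text \<open>
  If the supremum were finite, the separation of the centres would be bounded by \<open>L\<close>, yet grow at
  least like \<open>\<delta> t\<close>; at time \<open>T\<close> it has grown by at least \<open>2 L + 1\<close>, more than that bound permits.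
\<close>

lemma not_confined:
  "(SUP t. \<integral>\<^sup>+x. ennreal (\<bar>x - c t\<bar> * (mass_density u t x + energy_density p u t x)) \<partial>lborel) = \<infinity>"
  (is "(SUP t. ?J t) = \<infinity>")
proof (rule ccontr)
  assume "(SUP t. ?J t) \<noteq> \<infinity>"
  then obtain K' where K': "0 \<le> K'" "(SUP t. ?J t) = ennreal K'"
    by (cases "SUP t. ?J t") auto
  \<comment> \<open>The choice of the radius in the lower bound for \<open>\<integral>u f\<close> requires a positive bound.\<close>
  define K where "K = K' + 1"
  have K: "0 < K" "?J t \<le> ennreal K" for t
  proof -
    have "?J t \<le> ennreal K'" unfolding K'(2)[symmetric] by (rule SUP_upper) simp
    also have "\<dots> \<le> ennreal K" by (simp add: K_def ennreal_leI)
    finally show "?J t \<le> ennreal K" .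
    show "0 < K" using K' by (simp add: K_def)
  qed
  note moments = confined_moments[OF K(2) less_imp_le[OF K(1)]]
  obtain b where b: "0 < b" "\<And>t. b \<le> int_u_f t"
    using int_u_f_lower_bound_if_confined[OF K(1)] moments(1) by metis
  define \<delta> where "\<delta> = \<kappa> * b\<^sup>2 / (mass u 0 * energy p u 0)"
  define L where "L = K / mass u 0 + K / energy p u 0"
  let ?g = "\<lambda>t. centre_of_mass u t - centre_of_energy p u t"
  have \<delta>: "0 < \<delta>"
    using \<kappa>_pos b mass_pos energy_pos by (simp add: \<delta>_def)
  have speed: "\<delta> \<le> deriv (centre_of_mass u) t - deriv (centre_of_energy p u) t" for t
  proof -
    have "\<kappa> * b\<^sup>2 \<le> \<kappa> * (int_u_f t)\<^sup>2"
      using \<kappa>_pos b by (intro mult_left_mono power_mono) auto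
    then have "\<delta> \<le> \<kappa> * (int_u_f t)\<^sup>2 / (mass u t * energy p u t)"
      unfolding \<delta>_def mass_const[of 0 t] energy_const[of 0 t]
      using mass_pos[of t] energy_pos[of t] by (intro divide_right_mono) auto
    then show ?thesis using separation_speed[of t] by linarith
  qed
  have L: "\<bar>?g t\<bar> \<le> L" for t
    unfolding L_def by (rule centres_close_if_confined[OF moments])
  then have "0 \<le> L" using abs_ge_zero order_trans by blast
  define T where "T = (2 * L + 1) / \<delta>"
  have T: "0 \<le> T" "\<delta> * T = 2 * L + 1" using \<delta> \<open>0 \<le> L\<close> by (simp_all add: T_def)
  have "?g 0 - \<delta> * 0 \<le> ?g T - \<delta> * T"
  proof (rule DERIV_nonneg_imp_nondecreasing[OF T(1)], intro exI conjI)
    show "((\<lambda>t. ?g t - \<delta> * t) has_real_derivative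
        (deriv (centre_of_mass u) t - deriv (centre_of_energy p u) t - \<delta>)) (at t)" for t
      by (rule DERIV_diff[OF separation_derivative DERIV_cmult_Id])
  qed (use speed in simp)
  then show False using L[of 0] L[of T] T(2) by (simp add: abs_le_iff)
qed

end

theorem theorem1p7:
  fixes p :: real and u :: "real \<Rightarrow> real \<Rightarrow> real"
  assumes "p \<ge> sqrt 3"
    and "global_schwartz_solution p u"
    and "\<exists>t x. u t x \<noteq> 0"
  shows "(\<forall>t. centre_of_mass u differentiable (at t)
            \<and> centre_of_energy p u differentiable (at t)
            \<and> deriv (centre_of_mass u) t - deriv (centre_of_energy p u) t > 0)
       \<and> strict_antimono_on UNIV (\<lambda>t. centre_of_energy p u t - centre_of_mass u t)
       \<and> (\<forall>c :: real \<Rightarrow> real.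
            (SUP t. \<integral>\<^sup>+x. ennreal (\<bar>x - c t\<bar> * (mass_density u t x + energy_density p u t x)) \<partial>lborel)
              = \<infinity>)"
proof (intro conjI allI)
  interpret gKdV_solution p u by unfold_locales (rule assms)+
  show "centre_of_mass u differentiable (at t)" "centre_of_energy p u differentiable (at t)" for t
    using centre_of_mass_derivative centre_of_energy_derivative by (auto simp: real_differentiable_def)
  show "deriv (centre_of_mass u) t - deriv (centre_of_energy p u) t > 0" for t
    by (rule separation_speed_pos)
  show "strict_antimono_on UNIV (\<lambda>t. centre_of_energy p u t - centre_of_mass u t)"
  proof (rule monotone_onI)
    fix r s :: real assume "r < s"
    then have "centre_of_mass u r - centre_of_energy p u r < centre_of_mass u s - centre_of_energy p u s"
      by (rule DERIV_pos_imp_increasing) (use separation_derivative separation_speed_pos in blast)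
    then show "centre_of_energy p u s - centre_of_mass u s < centre_of_energy p u r - centre_of_mass u r"
      by linarith
  qed
  show "(SUP t. \<integral>\<^sup>+x. ennreal (\<bar>x - c t\<bar> * (mass_density u t x + energy_density p u t x)) \<partial>lborel) = \<infinity>"
    for c :: "real \<Rightarrow> real"
    by (rule not_confined)
qed

end
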